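(* Let $q\neq 2$ be even, let $G=\mathrm{SU}_3(q)$ or $\mathrm{PSU}_3(q)$, and let $\mathcal{C}$ be the conjugacy class of involutions in $G$. Then $\mathcal{K}(G,\mathcal{C})$ equals the commuting graph on $\mathcal{C}$, and $K_{\mathcal{C}}$ is reducible and non-degenerate.
   Context: For a finite group $G$ and a subset $\mathcal{C}\subseteq G\setminus\{1\}$ closed under conjugation, the Killing form $K_{\mathcal{C}}$ is the bilinear form on the complex vector space with basis $\mathcal{C}$ given on basis elements by $K_{\mathcal{C}}(a,b)=|C_G(ab)\cap\mathcal{C}|$; it is non-degenerate if the matrix $(K_{\mathcal{C}}(a,b))_{a,b\in\mathcal{C}}$ is invertible. $\mathcal{K}(G,\mathcal{C})$ is the graph with vertex set $\mathcal{C}$ in which distinct $a,b$ are adjacent iff $C_G(ab)\cap\mathcal{C}\neq\emptyset$. $K_{\mathcal{C}}$ is irreducible if $\mathcal{K}(G,\mathcal{C})$ is connected and reducible otherwise. The commuting graph on $\mathcal{C}$ has vertex set $\mathcal{C}$, with distinct $a,b$ adjacent iff $ab=ba$. *)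

theory Defs
  imports "HOL-Analysis.Analysis" "HOL-Algebra.Coset" "HOL-Combinatorics.Permutations"
begin

section \<open>Generic notions for a (finite) group G and a subset C\<close>

definition grp_centralizer :: "('g, 'b) monoid_scheme \<Rightarrow> 'g \<Rightarrow> 'g set" where
  "grp_centralizer G x = {g \<in> carrier G. g \<otimes>\<^bsub>G\<^esub> x = x \<otimes>\<^bsub>G\<^esub> g}"

definition grp_center :: "('g, 'b) monoid_scheme \<Rightarrow> 'g set" where
  "grp_center G = {z \<in> carrier G. \<forall>g \<in> carrier G. z \<otimes>\<^bsub>G\<^esub> g = g \<otimes>\<^bsub>G\<^esub> z}"

text \<open>The set of involutions of G (elements of order exactly 2).\<close>
definition involutions :: "('g, 'b) monoid_scheme \<Rightarrow> 'g set" where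
  "involutions G = {g \<in> carrier G. g \<noteq> \<one>\<^bsub>G\<^esub> \<and> g \<otimes>\<^bsub>G\<^esub> g = \<one>\<^bsub>G\<^esub>}"

text \<open>K_C(a,b) = |C_G(ab) \<inter> C| on basis elements.\<close>
definition killing :: "('g, 'b) monoid_scheme \<Rightarrow> 'g set \<Rightarrow> 'g \<Rightarrow> 'g \<Rightarrow> nat" where
  "killing G C a b = card (grp_centralizer G (a \<otimes>\<^bsub>G\<^esub> b) \<inter> C)"

text \<open>Determinant of a square complex matrix indexed by the finite set C (Leibniz formula).\<close>
definition det_on :: "'a set \<Rightarrow> ('a \<Rightarrow> 'a \<Rightarrow> complex) \<Rightarrow> complex" where
  "det_on C M = (\<Sum>p \<in> {p. p permutes C}. of_int (sign p) * (\<Prod>a\<in>C. M a (p a)))"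

text \<open>Non-degenerate: the Gram matrix (K_C(a,b))_{a,b in C} is invertible over the complex numbers.\<close>
definition killing_nondegenerate :: "('g, 'b) monoid_scheme \<Rightarrow> 'g set \<Rightarrow> bool" where
  "killing_nondegenerate G C \<longleftrightarrow> det_on C (\<lambda>a b. of_nat (killing G C a b)) \<noteq> 0"

text \<open>Adjacency in the graph K(G,C).\<close>
definition killing_adj :: "('g, 'b) monoid_scheme \<Rightarrow> 'g set \<Rightarrow> 'g \<Rightarrow> 'g \<Rightarrow> bool" where
  "killing_adj G C a b \<longleftrightarrow> a \<in> C \<and> b \<in> C \<and> a \<noteq> b \<and>
      grp_centralizer G (a \<otimes>\<^bsub>G\<^esub> b) \<inter> C \<noteq> {}"

text \<open>Adjacency in the commuting graph on C.\<close>
definition commuting_adj :: "('g, 'b) monoid_scheme \<Rightarrow> 'g set \<Rightarrow> 'g \<Rightarrow> 'g \<Rightarrow> bool" where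
  "commuting_adj G C a b \<longleftrightarrow> a \<in> C \<and> b \<in> C \<and> a \<noteq> b \<and> a \<otimes>\<^bsub>G\<^esub> b = b \<otimes>\<^bsub>G\<^esub> a"

text \<open>A graph on vertex set V with adjacency E is connected if any two vertices are joined by a path.\<close>
definition graph_connected :: "'a set \<Rightarrow> ('a \<Rightarrow> 'a \<Rightarrow> bool) \<Rightarrow> bool" where
  "graph_connected V E \<longleftrightarrow> (\<forall>a\<in>V. \<forall>b\<in>V. (a, b) \<in> {(x, y). x \<in> V \<and> y \<in> V \<and> E x y}\<^sup>*)"

definition killing_irreducible :: "('g, 'b) monoid_scheme \<Rightarrow> 'g set \<Rightarrow> bool" where
  "killing_irreducible G C \<longleftrightarrow> graph_connected C (killing_adj G C)"

definition killing_reducible :: "('g, 'b) monoid_scheme \<Rightarrow> 'g set \<Rightarrow> bool" where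
  "killing_reducible G C \<longleftrightarrow> \<not> killing_irreducible G C"

section \<open>SU_3(q) and PSU_3(q)\<close>

text \<open>'k is a finite field of order q^2; the field automorphism of order 2 is x \<mapsto> x^q.
  A^* is the conjugate transpose.  SU_3(q) is realised w.r.t. the standard Hermitian form
  (identity Gram matrix); all non-degenerate Hermitian forms over GF(q^2) are equivalent.\<close>
definition conj_transpose :: "nat \<Rightarrow> 'k::field^3^3 \<Rightarrow> 'k^3^3" where
  "conj_transpose q A = (\<chi> i j. (A $ j $ i) ^ q)"

definition SU3 :: "nat \<Rightarrow> ('k::{field,finite}^3^3) monoid" where
  "SU3 q = \<lparr> carrier = {A. A ** conj_transpose q A = mat 1 \<and> det A = 1},
            mult = (**), one = mat 1 \<rparr>"

definition PSU3 :: "nat \<Rightarrow> ('k::{field,finite}^3^3) set monoid" where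
  "PSU3 q = SU3 q Mod grp_center (SU3 q)"

end

theory Submission
  imports Defs "HOL-Algebra.Sylow" "HOL-Algebra.FiniteProduct" "HOL-Computational_Algebra.Primes"
begin

text \<open>
  For \<open>q\<close> even the field \<open>K\<close> of order \<open>q\<^sup>2\<close> has characteristic 2 and \<open>x \<mapsto> x\<^sup>q\<close> is an
  involutory automorphism, so \<open>h(u, v) = \<Sum>\<^sub>i u\<^sub>i v\<^sub>i\<^sup>q\<close> is a Hermitian form on \<open>K\<^sup>3\<close>. For a unitary
  involution \<open>a\<close>, \<open>N = a + 1\<close> is self-adjoint with \<open>N\<^sup>2 = 0\<close>; its image is totally isotropic,
  hence a line, and \<open>a\<close> is a transvection \<open>u \<mapsto> u + \<alpha> h(u, z) z\<close> with \<open>h(z, z) = 0\<close> and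
  \<open>\<alpha>\<^sup>q = \<alpha> \<noteq> 0\<close>. If \<open>a, b\<close> do not commute, their centres are not orthogonal; if an involution
  \<open>c\<close> with centre \<open>x\<close> commuted with \<open>ab\<close>, then \<open>ab x = \<mu> x\<close> with \<open>\<mu>\<^sup>q\<^sup>+\<^sup>1 = 1\<close>. Pairing
  \<open>b x = \<mu> a x\<close> with \<open>x\<close> writes \<open>\<mu>\<close> as a quotient of elements fixed by \<open>x \<mapsto> x\<^sup>q\<close> (unless
  \<open>x\<close> is orthogonal to the centre of \<open>a\<close>, which is impossible), so \<open>\<mu>\<^sup>2 = 1\<close> and \<open>\<mu> = 1\<close>;
  pairing with the centre of \<open>b\<close> then forces the centres of \<open>a\<close> and \<open>b\<close> to be orthogonal.

  So no involution centralises the product of two non-commuting involutions. In any finite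
  group with this property commuting is an equivalence relation on the set \<open>C\<close> of
  involutions, and \<open>C\<^sub>G(ab) \<inter> C\<close> is \<open>C\<close>, the class of \<open>a\<close>, or empty according as \<open>a = b\<close>,
  \<open>a \<noteq> b\<close> commute, or not. Hence the Killing graph is the commuting graph, it is
  disconnected as soon as two involutions do not commute, and the Killing matrix is block
  diagonal with invertible blocks \<open>(|C| - m) I + m J\<close>. The property passes to \<open>G/Z(G)\<close>:
  \<open>Z(G)\<close> contains no involution, so squaring is a bijection of \<open>Z(G)\<close>, involutions of
  \<open>G/Z(G)\<close> lift to involutions of \<open>G\<close>, and an involution commuting with \<open>g\<close> modulo
  \<open>Z(G)\<close> commutes with \<open>g\<close>.
\<close>

section \<open>Non-singular block matrices\<close>

lemma det_on_eq_det:
  fixes C :: "'a::finite set" and M :: "'a \<Rightarrow> 'a \<Rightarrow> complex"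
  shows "det_on C M = det (\<chi> i j. if i \<in> C \<and> j \<in> C then M i j else if i = j then 1 else 0)"
    (is "_ = det (\<chi> i j. ?M i j)")
proof -
  have "det (\<chi> i j. ?M i j) =
      (\<Sum>p\<in>{p. p permutes C}. of_int (sign p) * (\<Prod>i\<in>UNIV. (\<chi> i j. ?M i j) $ i $ p i))"
    unfolding det_def
  proof (rule sum.mono_neutral_right)
    show "{p. p permutes C} \<subseteq> {p. p permutes UNIV}"
      using permutes_subset by blast
    show "\<forall>p\<in>{p. p permutes UNIV} - {p. p permutes C}.
        of_int (sign p) * (\<Prod>i\<in>UNIV. (\<chi> i j. ?M i j) $ i $ p i) = 0"
    proof
      fix p assume p: "p \<in> {p. p permutes UNIV} - {p. p permutes C}"
      then obtain i where "i \<notin> C" "p i \<noteq> i"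
        by (auto simp: permutes_def)
      then show "of_int (sign p) * (\<Prod>i\<in>UNIV. (\<chi> i j. ?M i j) $ i $ p i) = 0"
        by (auto intro!: prod_zero bexI[of _ i])
    qed
  qed (auto simp: finite_permutations)
  also have "\<dots> = det_on C M"
    unfolding det_on_def
  proof (rule sum.cong[OF refl])
    fix p assume "p \<in> {p. p permutes C}"
    then have p: "p permutes C" by simp
    have "(\<Prod>i\<in>UNIV. ?M i (p i)) = (\<Prod>i\<in>C. ?M i (p i))"
      by (rule prod.mono_neutral_right) (use p in \<open>auto simp: permutes_not_in\<close>)
    also have "\<dots> = (\<Prod>i\<in>C. M i (p i))"
      using permutes_in_image[OF p] by (auto intro!: prod.cong)
    finally show "of_int (sign p) * (\<Prod>i\<in>UNIV. (\<chi> i j. ?M i j) $ i $ p i) =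
        of_int (sign p) * (\<Prod>i\<in>C. M i (p i))"
      by simp
  qed
  finally show ?thesis ..
qed

lemma det_on_nonzero:
  fixes C :: "'a::finite set" and M :: "'a \<Rightarrow> 'a \<Rightarrow> complex"
  assumes ker: "\<And>x. \<forall>a\<in>C. (\<Sum>b\<in>C. M a b * x b) = 0 \<Longrightarrow> \<forall>a\<in>C. x a = 0"
  shows "det_on C M \<noteq> 0"
proof -
  define A where "A = (\<chi> i j. if i \<in> C \<and> j \<in> C then M i j else if i = j then 1 else (0::complex))"
  have "x = 0" if Ax: "A *v x = 0" for x
  proof -
    have "(\<Sum>j\<in>UNIV. A $ i $ j * x $ j) = (if i \<in> C then (\<Sum>j\<in>C. M i j * x $ j) else x $ i)" for i
      by (cases "i \<in> C") (auto simp: A_def if_distrib[of "\<lambda>t. t * _"] sum.If_cases Int_absorb1 cong: if_cong)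
    moreover have "(\<Sum>j\<in>UNIV. A $ i $ j * x $ j) = 0" for i
      using Ax by (simp add: vec_eq_iff matrix_vector_mult_def)
    ultimately have row: "(if i \<in> C then (\<Sum>j\<in>C. M i j * x $ j) else x $ i) = 0" for i
      by metis
    have "x $ i = 0" for i
    proof (cases "i \<in> C")
      case True
      then show ?thesis
        using ker[of "\<lambda>j. x $ j"] row by (metis (full_types))
    next
      case False
      then show ?thesis
        using row[of i] by simp
    qed
    then show ?thesis
      by (simp add: vec_eq_iff)
  qed
  then have "det A \<noteq> 0"
    by (metis invertible_det_nz invertible_left_inverse matrix_left_invertible_ker)
  then show ?thesis
    by (simp add: det_on_eq_det A_def)
qed

(* Summing the equations of one class shows that x sums to zero over every class; each
   equation then reduces to (card C - card (cls a)) * x a = 0. *)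
lemma block_matrix_kernel_trivial:
  fixes C :: "'a set" and cls :: "'a \<Rightarrow> 'a set" and x :: "'a \<Rightarrow> complex"
  assumes fin: "finite C"
    and cls: "\<And>a. a \<in> C \<Longrightarrow> a \<in> cls a \<and> cls a \<subseteq> C \<and> card (cls a) < card C"
    and cls_eq: "\<And>a b. a \<in> C \<Longrightarrow> b \<in> cls a \<Longrightarrow> cls b = cls a"
    and ker: "\<forall>a\<in>C. (\<Sum>b\<in>C. (if a = b then of_nat (card C)
                 else if b \<in> cls a then of_nat (card (cls a)) else 0) * x b) = 0"
  shows "\<forall>a\<in>C. x a = 0"
proof
  fix a assume a: "a \<in> C"
  define m where "m = card (cls a)"
  define S where "S = (\<Sum>b\<in>cls a. x b)"
  have m: "m < card C"
    using cls[OF a] by (simp add: m_def)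
  have row: "(of_nat (card C) - of_nat m) * x a' + of_nat m * S = 0" if a': "a' \<in> cls a" for a'
  proof -
    have a'C: "a' \<in> C" and cls_a': "cls a' = cls a"
      using cls[OF a] cls_eq[OF a a'] a' by auto
    have "(\<Sum>b\<in>C. (if a' = b then of_nat (card C) else if b \<in> cls a then of_nat m else 0) * x b)
        = (\<Sum>b\<in>C. (if a' = b then (of_nat (card C) - of_nat m) * x b else 0)
            + (if b \<in> cls a then of_nat m * x b else 0))"
      using a' by (intro sum.cong) (auto simp: algebra_simps)
    also have "\<dots> = (of_nat (card C) - of_nat m) * x a' + of_nat m * S"
      using a'C cls[OF a] fin
      by (simp add: sum.distrib sum.If_cases Int_absorb1 S_def sum_distrib_left)
    finally show ?thesis
      using bspec[OF ker a'C] unfolding cls_a' m_def by simp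
  qed
  have "(\<Sum>a'\<in>cls a. (of_nat (card C) - of_nat m) * x a' + of_nat m * S) =
      (of_nat (card C) - of_nat m) * S + of_nat m * (of_nat m * S)"
    by (simp add: sum.distrib S_def m_def sum_distrib_left)
  also have "\<dots> = of_nat (card C - m + m * m) * S"
    using m by (simp add: of_nat_diff algebra_simps)
  finally have "of_nat (card C - m + m * m) * S = 0"
    using row by simp
  moreover have "card C - m + m * m \<noteq> 0"
    using m by simp
  ultimately have "S = 0"
    by (metis mult_eq_0_iff of_nat_eq_0_iff)
  moreover have "(of_nat (card C) - of_nat m :: complex) \<noteq> 0"
    using m by simp
  ultimately show "x a = 0"
    using row[of a] cls[OF a] by simp
qed

section \<open>Involutions centralising no product of non-commuting involutions\<close>

definition product_centralizers_avoid_involutions :: "('g, 'b) monoid_scheme \<Rightarrow> bool" where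
  "product_centralizers_avoid_involutions G \<longleftrightarrow>
     (\<forall>a \<in> involutions G. \<forall>b \<in> involutions G. a \<otimes>\<^bsub>G\<^esub> b \<noteq> b \<otimes>\<^bsub>G\<^esub> a \<longrightarrow>
        grp_centralizer G (a \<otimes>\<^bsub>G\<^esub> b) \<inter> involutions G = {})"

lemma product_centralizers_avoid_involutionsI:
  assumes "\<And>a b c. a \<in> involutions G \<Longrightarrow> b \<in> involutions G \<Longrightarrow> c \<in> involutions G \<Longrightarrow>
      a \<otimes>\<^bsub>G\<^esub> b \<noteq> b \<otimes>\<^bsub>G\<^esub> a \<Longrightarrow> c \<otimes>\<^bsub>G\<^esub> (a \<otimes>\<^bsub>G\<^esub> b) \<noteq> (a \<otimes>\<^bsub>G\<^esub> b) \<otimes>\<^bsub>G\<^esub> c"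
  shows "product_centralizers_avoid_involutions G"
  using assms unfolding product_centralizers_avoid_involutions_def grp_centralizer_def
  by (auto simp: involutions_def)

context group
begin

lemma involutionsD:
  assumes "a \<in> involutions G"
  shows "a \<in> carrier G" "a \<noteq> \<one>" "a \<otimes> a = \<one>"
  using assms by (simp_all add: involutions_def)

lemma commute_mult:
  assumes "x \<in> carrier G" "a \<in> carrier G" "b \<in> carrier G"
    and xa: "x \<otimes> a = a \<otimes> x" and xb: "x \<otimes> b = b \<otimes> x"
  shows "x \<otimes> (a \<otimes> b) = (a \<otimes> b) \<otimes> x"
proof -
  have "x \<otimes> (a \<otimes> b) = (a \<otimes> x) \<otimes> b"
    using assms(1-3) by (simp add: xa flip: m_assoc)
  also have "\<dots> = a \<otimes> (b \<otimes> x)"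
    using assms(1-3) by (simp add: xb m_assoc)
  also have "\<dots> = (a \<otimes> b) \<otimes> x"
    using assms(1-3) by (simp add: m_assoc)
  finally show ?thesis .
qed

lemma square_commuting_mult:
  assumes "x \<in> carrier G" "y \<in> carrier G" and xy: "x \<otimes> y = y \<otimes> x"
  shows "(x \<otimes> y) \<otimes> (x \<otimes> y) = (x \<otimes> x) \<otimes> (y \<otimes> y)"
proof -
  have "(x \<otimes> y) \<otimes> (x \<otimes> y) = x \<otimes> ((y \<otimes> x) \<otimes> y)"
    using assms(1,2) by (simp add: m_assoc)
  also have "\<dots> = (x \<otimes> x) \<otimes> (y \<otimes> y)"
    using assms(1,2) by (simp add: m_assoc flip: xy)
  finally show ?thesis .
qed

lemma product_centralizers_avoid_involutionsD:
  assumes "product_centralizers_avoid_involutions G"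
    and "a \<in> involutions G" "b \<in> involutions G" "c \<in> involutions G" "a \<otimes> b \<noteq> b \<otimes> a"
  shows "c \<otimes> (a \<otimes> b) \<noteq> (a \<otimes> b) \<otimes> c"
  using assms involutionsD(1)[of c]
  unfolding product_centralizers_avoid_involutions_def grp_centralizer_def by blast

lemma involutions_commute_trans:
  assumes P: "product_centralizers_avoid_involutions G"
    and a: "a \<in> involutions G" and b: "b \<in> involutions G" and c: "c \<in> involutions G"
    and ab: "a \<otimes> b = b \<otimes> a" and bc: "b \<otimes> c = c \<otimes> b"
  shows "a \<otimes> c = c \<otimes> a"
proof (rule ccontr)
  note carr = involutionsD(1)[OF a] involutionsD(1)[OF b] involutionsD(1)[OF c]
  assume "a \<otimes> c \<noteq> c \<otimes> a"
  moreover have "b \<otimes> (a \<otimes> c) = (a \<otimes> c) \<otimes> b"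
    using commute_mult[OF carr(2,1,3) ab[symmetric] bc] .
  ultimately show False
    using product_centralizers_avoid_involutionsD[OF P a c b] by blast
qed

lemma commuting_involutions_product:
  assumes a: "a \<in> involutions G" and b: "b \<in> involutions G"
    and "a \<noteq> b" and ab: "a \<otimes> b = b \<otimes> a"
  shows "a \<otimes> b \<in> involutions G"
proof -
  note carr = involutionsD(1)[OF a] involutionsD(1)[OF b]
  have "a \<otimes> b \<noteq> \<one>"
    using assms(3) carr involutionsD(3)[OF a] by (metis Units_eq Units_l_cancel)
  moreover have "(a \<otimes> b) \<otimes> (a \<otimes> b) = \<one>"
    using square_commuting_mult[OF carr ab] involutionsD(3)[OF a] involutionsD(3)[OF b] by simp
  ultimately show ?thesis
    using carr by (simp add: involutions_def)
qed

lemma centralizer_involutions_eq: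
  assumes P: "product_centralizers_avoid_involutions G"
    and a: "a \<in> involutions G" and b: "b \<in> grp_centralizer G a \<inter> involutions G"
  shows "grp_centralizer G b \<inter> involutions G = grp_centralizer G a \<inter> involutions G"
proof -
  have bC: "b \<in> involutions G" and ba: "b \<otimes> a = a \<otimes> b"
    using b by (auto simp: grp_centralizer_def)
  have "c \<otimes> b = b \<otimes> c \<longleftrightarrow> c \<otimes> a = a \<otimes> c" if c: "c \<in> involutions G" for c
    using involutions_commute_trans[OF P, of c b a] involutions_commute_trans[OF P, of c a b]
      a bC c ba by auto
  then show ?thesis
    by (auto simp: grp_centralizer_def)
qed

lemma centralizer_involutions_psubset:
  assumes P: "product_centralizers_avoid_involutions G"
    and u: "u \<in> involutions G" and v: "v \<in> involutions G" and uv: "u \<otimes> v \<noteq> v \<otimes> u"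
    and a: "a \<in> involutions G"
  shows "grp_centralizer G a \<inter> involutions G \<subset> involutions G"
proof -
  have "u \<otimes> a \<noteq> a \<otimes> u \<or> v \<otimes> a \<noteq> a \<otimes> v"
    using involutions_commute_trans[OF P u a v] uv by metis
  then have "u \<notin> grp_centralizer G a \<or> v \<notin> grp_centralizer G a"
    by (auto simp: grp_centralizer_def)
  then show ?thesis
    using u v by blast
qed

lemma centralizer_product_involutions:
  assumes P: "product_centralizers_avoid_involutions G"
    and a: "a \<in> involutions G" and b: "b \<in> involutions G"
  shows "grp_centralizer G (a \<otimes> b) \<inter> involutions G =
    (if a = b then involutions G
     else if a \<otimes> b = b \<otimes> a then grp_centralizer G a \<inter> involutions G else {})"
proof -
  note carr = involutionsD(1)[OF a] involutionsD(1)[OF b]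
  consider "a = b" | "a \<noteq> b" "a \<otimes> b = b \<otimes> a" | "a \<otimes> b \<noteq> b \<otimes> a"
    by blast
  then show ?thesis
  proof cases
    case 1
    then show ?thesis
      using involutionsD[OF a] by (auto simp: grp_centralizer_def involutions_def)
  next
    case 2
    have "a \<otimes> b \<in> grp_centralizer G a \<inter> involutions G"
      using commuting_involutions_product[OF a b 2] commute_mult[OF carr(1,1,2) refl 2(2)] carr
      by (simp add: grp_centralizer_def)
    then show ?thesis
      using centralizer_involutions_eq[OF P a] 2 by simp
  next
    case 3
    then show ?thesis
      using P a b unfolding product_centralizers_avoid_involutions_def by auto
  qed
qed

lemma killing_involutions:
  assumes P: "product_centralizers_avoid_involutions G"
    and a: "a \<in> involutions G" and b: "b \<in> involutions G"
  shows "killing G (involutions G) a b =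
    (if a = b then card (involutions G)
     else if a \<otimes> b = b \<otimes> a then card (grp_centralizer G a \<inter> involutions G) else 0)"
  using centralizer_product_involutions[OF P a b] by (simp add: killing_def)

lemma killing_adj_iff_commuting_adj:
  assumes P: "product_centralizers_avoid_involutions G"
  shows "killing_adj G (involutions G) a b \<longleftrightarrow> commuting_adj G (involutions G) a b"
proof (cases "a \<in> involutions G \<and> b \<in> involutions G")
  case True
  then have "a \<in> grp_centralizer G a \<inter> involutions G"
    by (auto simp: grp_centralizer_def dest: involutionsD(1))
  then show ?thesis
    using True centralizer_product_involutions[OF P, of a b]
    unfolding killing_adj_def commuting_adj_def by auto
qed (auto simp: killing_adj_def commuting_adj_def)

lemma killing_reducible_if_noncommuting:
  assumes P: "product_centralizers_avoid_involutions G"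
    and u: "u \<in> involutions G" and v: "v \<in> involutions G" and uv: "u \<otimes> v \<noteq> v \<otimes> u"
  shows "killing_reducible G (involutions G)"
proof -
  let ?E = "{(x, y). x \<in> involutions G \<and> y \<in> involutions G \<and> killing_adj G (involutions G) x y}"
  have "y \<in> involutions G \<and> u \<otimes> y = y \<otimes> u" if "(u, y) \<in> ?E\<^sup>*" for y
    using that
  proof (induction rule: rtrancl_induct)
    case (step y z)
    then show ?case
      using involutions_commute_trans[OF P u, of y z]
      by (auto simp: killing_adj_iff_commuting_adj[OF P] commuting_adj_def)
  qed (use u in simp)
  then show ?thesis
    using u v uv
    unfolding killing_reducible_def killing_irreducible_def graph_connected_def by blast
qed

end

lemma killing_nondegenerate_if_noncommuting:
  fixes G :: "('g::finite, 'b) monoid_scheme" (structure)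
  assumes "group G" and P: "product_centralizers_avoid_involutions G"
    and u: "u \<in> involutions G" and v: "v \<in> involutions G" and uv: "u \<otimes> v \<noteq> v \<otimes> u"
  shows "killing_nondegenerate G (involutions G)"
proof -
  interpret group G by fact
  define C where "C = involutions G"
  define cls where "cls a = grp_centralizer G a \<inter> C" for a
  have killing: "of_nat (killing G C a b) =
      (if a = b then of_nat (card C) else if b \<in> cls a then of_nat (card (cls a)) else (0::complex))"
    if "a \<in> C" "b \<in> C" for a b
    using that killing_involutions[OF P, of a b]
    by (auto simp: C_def cls_def grp_centralizer_def dest: involutionsD(1))
  have "\<forall>a\<in>C. x a = 0" if ker: "\<forall>a\<in>C. (\<Sum>b\<in>C. of_nat (killing G C a b) * x b) = 0"
    for x :: "'g \<Rightarrow> complex"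
  proof (rule block_matrix_kernel_trivial[where cls = cls])
    show "a \<in> cls a \<and> cls a \<subseteq> C \<and> card (cls a) < card C" if "a \<in> C" for a
      using that psubset_card_mono[OF _ centralizer_involutions_psubset[OF P u v uv, of a]]
      by (auto simp: cls_def C_def grp_centralizer_def dest: involutionsD(1))
    show "cls b = cls a" if "a \<in> C" "b \<in> cls a" for a b
      using centralizer_involutions_eq[OF P] that by (simp add: cls_def C_def)
    show "\<forall>a\<in>C. (\<Sum>b\<in>C. (if a = b then of_nat (card C)
        else if b \<in> cls a then of_nat (card (cls a)) else 0) * x b) = 0"
      using ker killing by (auto cong: sum.cong)
  qed simp
  then show ?thesis
    unfolding killing_nondegenerate_def C_def[symmetric] by (rule det_on_nonzero)
qed

lemma killing_form_of_involutions:
  fixes G :: "('g::finite, 'b) monoid_scheme" (structure)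
  assumes "group G" and P: "product_centralizers_avoid_involutions G"
    and "\<exists>u\<in>involutions G. \<exists>v\<in>involutions G. u \<otimes> v \<noteq> v \<otimes> u"
  shows "(\<forall>a b. killing_adj G (involutions G) a b \<longleftrightarrow> commuting_adj G (involutions G) a b)
    \<and> killing_reducible G (involutions G) \<and> killing_nondegenerate G (involutions G)"
proof -
  obtain u v where "u \<in> involutions G" "v \<in> involutions G" "u \<otimes> v \<noteq> v \<otimes> u"
    using assms(3) by blast
  then show ?thesis
    using group.killing_adj_iff_commuting_adj[OF assms(1,2)]
      group.killing_reducible_if_noncommuting[OF assms(1,2)]
      killing_nondegenerate_if_noncommuting[OF assms(1,2)] by blast
qed

section \<open>Quotient by the centre\<close>

context group
begin

lemma center_commute:
  assumes "z \<in> grp_center G"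
  shows "z \<in> carrier G" "g \<in> carrier G \<Longrightarrow> z \<otimes> g = g \<otimes> z"
  using assms by (auto simp: grp_center_def)

lemma center_normal: "grp_center G \<lhd> G"
proof -
  have "subgroup (grp_center G) G"
  proof (rule subgroupI)
    show "grp_center G \<subseteq> carrier G" "grp_center G \<noteq> {}"
      by (auto simp: grp_center_def)
  next
    fix z assume z: "z \<in> grp_center G"
    have "inv z \<otimes> g = g \<otimes> inv z" if g: "g \<in> carrier G" for g
    proof -
      note zc = center_commute[OF z]
      have "inv z \<otimes> g = inv z \<otimes> (g \<otimes> z) \<otimes> inv z"
        using zc(1) g by (simp add: m_assoc)
      also have "\<dots> = inv z \<otimes> (z \<otimes> g) \<otimes> inv z"
        using zc(2)[OF g] by simp
      also have "\<dots> = g \<otimes> inv z"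
        using zc(1) g by (simp flip: m_assoc)
      finally show ?thesis .
    qed
    then show "inv z \<in> grp_center G"
      using center_commute(1)[OF z] by (simp add: grp_center_def)
  next
    fix y z assume y: "y \<in> grp_center G" and z: "z \<in> grp_center G"
    have "g \<otimes> (y \<otimes> z) = (y \<otimes> z) \<otimes> g" if "g \<in> carrier G" for g
      using commute_mult[OF that center_commute(1)[OF y] center_commute(1)[OF z]]
        center_commute(2)[OF y that] center_commute(2)[OF z that] by simp
    then show "y \<otimes> z \<in> grp_center G"
      using center_commute(1)[OF y] center_commute(1)[OF z] by (simp add: grp_center_def)
  qed
  moreover have "x \<otimes> h \<otimes> inv x \<in> grp_center G" if "x \<in> carrier G" "h \<in> grp_center G" for x h
  proof -
    have "x \<otimes> h \<otimes> inv x = h \<otimes> x \<otimes> inv x"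
      using center_commute(2)[OF that(2,1)] by simp
    also have "\<dots> = h"
      using that center_commute(1)[OF that(2)] by (simp add: m_assoc)
    finally show ?thesis
      using that(2) by simp
  qed
  ultimately show ?thesis
    by (simp add: normal_inv_iff)
qed

lemma center_no_involutions:
  assumes P: "product_centralizers_avoid_involutions G"
    and u: "u \<in> involutions G" and v: "v \<in> involutions G" and uv: "u \<otimes> v \<noteq> v \<otimes> u"
  shows "grp_center G \<inter> involutions G = {}"
proof -
  have "z \<notin> involutions G" if "z \<in> grp_center G" for z
    using product_centralizers_avoid_involutionsD[OF P u v _ uv, of z]
      center_commute(2)[OF that, of "u \<otimes> v"] involutionsD(1)[OF u] involutionsD(1)[OF v]
    by auto
  then show ?thesis
    by blast
qed

lemma rcos_center_eqE:
  assumes "x \<in> carrier G" "y \<in> carrier G" "grp_center G #> x = grp_center G #> y"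
  obtains z where "z \<in> grp_center G" "x = z \<otimes> y"
  using rcos_self[OF assms(1) normal_imp_subgroup[OF center_normal]] assms(3)
  unfolding r_coset_def by auto

lemma involution_commute_mod_center:
  assumes Z: "grp_center G \<inter> involutions G = {}"
    and c: "c \<in> involutions G" and g: "g \<in> carrier G"
    and cg: "grp_center G #> (c \<otimes> g) = grp_center G #> (g \<otimes> c)"
  shows "c \<otimes> g = g \<otimes> c"
proof -
  note cc = involutionsD[OF c]
  obtain z where z: "z \<in> grp_center G" "c \<otimes> g = z \<otimes> (g \<otimes> c)"
    using rcos_center_eqE[OF _ _ cg] cc(1) g by auto
  note zc = center_commute[OF z(1)]
  have zc_c: "c \<otimes> z = z \<otimes> c"
    using zc(2)[OF cc(1)] by simp
  have "g = c \<otimes> (c \<otimes> g)"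
    using cc g by (simp flip: m_assoc)
  also have "\<dots> = c \<otimes> (z \<otimes> (g \<otimes> c))"
    by (simp only: z(2))
  also have "\<dots> = z \<otimes> ((c \<otimes> g) \<otimes> c)"
    using zc(1) cc(1) g by (simp add: zc_c flip: m_assoc)
  also have "\<dots> = z \<otimes> ((z \<otimes> (g \<otimes> c)) \<otimes> c)"
    by (simp only: z(2))
  also have "\<dots> = (z \<otimes> z) \<otimes> g"
    using zc(1) cc g by (simp add: m_assoc)
  finally have "z \<otimes> z = \<one>"
    using zc(1) g by simp
  then have "z = \<one>"
    using Z z(1) zc(1) by (auto simp: involutions_def)
  then show ?thesis
    using z(2) g cc(1) by simp
qed

lemma center_square_surj:
  assumes fin: "finite (carrier G)" and Z: "grp_center G \<inter> involutions G = {}"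
    and x: "x \<in> grp_center G"
  obtains w where "w \<in> grp_center G" "w \<otimes> w = x"
proof -
  interpret Z: subgroup "grp_center G" G
    using normal_imp_subgroup[OF center_normal] .
  have "inj_on (\<lambda>w. w \<otimes> w) (grp_center G)"
  proof (rule inj_onI)
    fix w y assume w: "w \<in> grp_center G" and y: "y \<in> grp_center G" and wy: "w \<otimes> w = y \<otimes> y"
    note wc = center_commute[OF w] and yc = center_commute[OF y]
    have "(w \<otimes> inv y) \<otimes> (w \<otimes> inv y) = (w \<otimes> w) \<otimes> inv (y \<otimes> y)"
      using square_commuting_mult[OF wc(1) inv_closed[OF yc(1)]] wc(1) yc(1)
        center_commute(2)[OF Z.m_inv_closed[OF y] wc(1)] by (simp add: inv_mult_group)
    also have "\<dots> = \<one>"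
      unfolding wy using yc(1) by simp
    finally have sq: "(w \<otimes> inv y) \<otimes> (w \<otimes> inv y) = \<one>" .
    have "w \<otimes> inv y \<in> grp_center G"
      using w y by (intro Z.m_closed Z.m_inv_closed)
    then have "w \<otimes> inv y \<notin> involutions G"
      using Z by blast
    then have "w \<otimes> inv y = \<one>"
      using sq wc(1) yc(1) by (simp add: involutions_def)
    have "w = (w \<otimes> inv y) \<otimes> y"
      using wc(1) yc(1) by (simp add: m_assoc)
    also have "\<dots> = y"
      using \<open>w \<otimes> inv y = \<one>\<close> yc(1) by simp
    finally show "w = y" .
  qed
  moreover have "(\<lambda>w. w \<otimes> w) ` grp_center G \<subseteq> grp_center G"
    using Z.m_closed by blast
  ultimately have "(\<lambda>w. w \<otimes> w) ` grp_center G = grp_center G"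
    using endo_inj_surj[OF finite_subset[OF Z.subset fin]] by blast
  then have "x \<in> (\<lambda>w. w \<otimes> w) ` grp_center G"
    using x by simp
  then show ?thesis
    using that by blast
qed

lemma involution_lift_mod_center:
  assumes fin: "finite (carrier G)" and Z: "grp_center G \<inter> involutions G = {}"
    and X: "X \<in> involutions (G Mod grp_center G)"
  obtains a where "a \<in> involutions G" "X = grp_center G #> a"
proof -
  interpret N: normal "grp_center G" G
    by (rule center_normal)
  obtain g where g: "g \<in> carrier G" "X = grp_center G #> g"
    using X unfolding involutions_def carrier_FactGroup by blast
  have "grp_center G #> (g \<otimes> g) = grp_center G"
    using X g by (simp add: involutions_def N.rcos_sum)
  then have gg: "g \<otimes> g \<in> grp_center G"
    using rcos_self[OF m_closed[OF g(1) g(1)] N.subgroup_axioms] by simp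
  have "g \<notin> grp_center G"
    using X g coset_join2[OF g(1) N.subgroup_axioms] by (auto simp: involutions_def)
  obtain w where w: "w \<in> grp_center G" "w \<otimes> w = g \<otimes> g"
    using center_square_surj[OF fin Z gg] by blast
  note wc = center_commute[OF w(1)]
  define a where "a = inv w \<otimes> g"
  have iw: "inv w \<in> grp_center G"
    using w(1) N.m_inv_closed by blast
  have "a \<otimes> a = inv (w \<otimes> w) \<otimes> (g \<otimes> g)"
    using square_commuting_mult[OF inv_closed[OF wc(1)] g(1)] center_commute(2)[OF iw g(1)] wc(1)
    by (simp add: a_def inv_mult_group)
  also have "\<dots> = \<one>"
    using wc(1) by (simp add: w(2)[symmetric])
  finally have "a \<otimes> a = \<one>" .
  moreover have "a \<noteq> \<one>"
    using \<open>g \<notin> grp_center G\<close> w(1) wc(1) g(1) by (auto simp: a_def inv_solve_left')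
  moreover have "a \<in> grp_center G #> g"
    using iw unfolding a_def r_coset_def by blast
  then have "X = grp_center G #> a"
    using repr_independence[OF _ g(1) N.subgroup_axioms] g(2) by simp
  moreover have "a \<in> carrier G"
    using g(1) wc(1) by (simp add: a_def)
  ultimately show ?thesis
    using that[of a] by (simp add: involutions_def)
qed

lemma rcos_center_involution:
  assumes a: "a \<in> involutions G" and "a \<notin> grp_center G"
  shows "grp_center G #> a \<in> involutions (G Mod grp_center G)"
proof -
  interpret N: normal "grp_center G" G
    by (rule center_normal)
  note ac = involutionsD[OF a]
  have "grp_center G #> a \<noteq> grp_center G"
    using rcos_self[OF ac(1) N.subgroup_axioms] assms(2) by auto
  moreover have "grp_center G #> a <#> (grp_center G #> a) = grp_center G"
    using ac by (simp add: N.rcos_sum coset_mult_one N.subset)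
  ultimately show ?thesis
    using ac(1) by (auto simp: involutions_def carrier_FactGroup)
qed

lemma Mod_center_product_centralizers_avoid_involutions:
  assumes fin: "finite (carrier G)" and Z: "grp_center G \<inter> involutions G = {}"
    and P: "product_centralizers_avoid_involutions G"
  shows "product_centralizers_avoid_involutions (G Mod grp_center G)"
proof (rule product_centralizers_avoid_involutionsI)
  interpret N: normal "grp_center G" G
    by (rule center_normal)
  fix X Y W
  assume X: "X \<in> involutions (G Mod grp_center G)" and Y: "Y \<in> involutions (G Mod grp_center G)"
    and W: "W \<in> involutions (G Mod grp_center G)"
    and XY: "X \<otimes>\<^bsub>G Mod grp_center G\<^esub> Y \<noteq> Y \<otimes>\<^bsub>G Mod grp_center G\<^esub> X"
  obtain a where a: "a \<in> involutions G" "X = grp_center G #> a"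
    using involution_lift_mod_center[OF fin Z X] by blast
  obtain b where b: "b \<in> involutions G" "Y = grp_center G #> b"
    using involution_lift_mod_center[OF fin Z Y] by blast
  obtain c where c: "c \<in> involutions G" "W = grp_center G #> c"
    using involution_lift_mod_center[OF fin Z W] by blast
  note abc = involutionsD(1)[OF a(1)] involutionsD(1)[OF b(1)] involutionsD(1)[OF c(1)]
  have "a \<otimes> b \<noteq> b \<otimes> a"
    using XY a(2) b(2) abc by (auto simp: N.rcos_sum)
  then have "c \<otimes> (a \<otimes> b) \<noteq> (a \<otimes> b) \<otimes> c"
    using product_centralizers_avoid_involutionsD[OF P a(1) b(1) c(1)] by blast
  then show "W \<otimes>\<^bsub>G Mod grp_center G\<^esub> (X \<otimes>\<^bsub>G Mod grp_center G\<^esub> Y) \<noteq>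
      (X \<otimes>\<^bsub>G Mod grp_center G\<^esub> Y) \<otimes>\<^bsub>G Mod grp_center G\<^esub> W"
    using involution_commute_mod_center[OF Z c(1), of "a \<otimes> b"] a(2) b(2) c(2) abc
    by (auto simp: N.rcos_sum)
qed

lemma Mod_center_noncommuting_involutions:
  assumes Z: "grp_center G \<inter> involutions G = {}"
    and u: "u \<in> involutions G" and v: "v \<in> involutions G" and uv: "u \<otimes> v \<noteq> v \<otimes> u"
  shows "\<exists>X\<in>involutions (G Mod grp_center G). \<exists>Y\<in>involutions (G Mod grp_center G).
    X \<otimes>\<^bsub>G Mod grp_center G\<^esub> Y \<noteq> Y \<otimes>\<^bsub>G Mod grp_center G\<^esub> X"
proof -
  interpret N: normal "grp_center G" G
    by (rule center_normal)
  note uvc = involutionsD(1)[OF u] involutionsD(1)[OF v]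
  have "u \<notin> grp_center G" "v \<notin> grp_center G"
    using uv uvc center_commute(2) by metis+
  then have "grp_center G #> u \<in> involutions (G Mod grp_center G)"
    "grp_center G #> v \<in> involutions (G Mod grp_center G)"
    using rcos_center_involution u v by blast+
  moreover have "grp_center G #> (u \<otimes> v) \<noteq> grp_center G #> (v \<otimes> u)"
    using involution_commute_mod_center[OF Z u uvc(2)] uv by blast
  ultimately show ?thesis
    using uvc by (intro bexI[of _ "grp_center G #> u"] bexI[of _ "grp_center G #> v"])
      (simp_all add: N.rcos_sum)
qed

end

section \<open>Finite fields of even order\<close>

lemma finite_field_power_card:
  fixes x :: "'a::{field,finite}"
  shows "x ^ CARD('a) = x"
proof (cases "x = 0")
  case False
  define M :: "'a monoid" where "M = \<lparr>carrier = UNIV - {0 :: 'a}, mult = (*), one = 1\<rparr>"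
  interpret comm_group M
    by (rule comm_groupI) (auto simp: M_def mult.assoc mult.commute intro!: bexI[of _ "inverse x" for x])
  have pow: "y [^]\<^bsub>M\<^esub> n = y ^ n" for y :: 'a and n :: nat
    by (induction n) (simp_all add: M_def mult.commute)
  have "x [^]\<^bsub>M\<^esub> card (carrier M) = \<one>\<^bsub>M\<^esub>"
    using False by (intro power_order_eq_one) (simp_all add: M_def)
  then have "x ^ card (UNIV - {0 :: 'a}) = 1"
    unfolding pow by (simp add: M_def)
  then have "x ^ (CARD('a) - 1) = 1"
    by (simp add: card_Diff_singleton)
  moreover have "CARD('a) = Suc (CARD('a) - 1)"
    using finite_UNIV_card_ge_0[where 'a='a] by simp
  ultimately show ?thesis
    by (metis power_Suc mult_1_right)
qed simp

lemma power_of_two_if_prime_factors_two: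
  fixes n :: nat
  assumes "n > 0" and "\<And>p. prime p \<Longrightarrow> p dvd n \<Longrightarrow> p = 2"
  shows "\<exists>k. n = 2 ^ k"
proof -
  have "prime_factors n \<subseteq> {2}"
    using assms(2) by (auto simp: in_prime_factors_iff)
  then have "(\<Prod>p\<in>prime_factors n. p ^ multiplicity p n) = (\<Prod>p\<in>{2}. p ^ multiplicity p n)"
    by (intro prod.mono_neutral_left) (auto simp: not_dvd_imp_multiplicity_0 prime_factors_multiplicity)
  then show ?thesis
    using prime_factorization_nat[OF assms(1)] by auto
qed

lemma card_power_of_two_if_exponent_two:
  assumes "\<And>x::'a::{ab_group_add,finite}. x + x = 0"
  shows "\<exists>n. CARD('a) = 2 ^ n"
proof (rule power_of_two_if_prime_factors_two)
  show "CARD('a) > 0" by simp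
  define G :: "'a monoid" where "G = \<lparr>carrier = UNIV :: 'a set, mult = (+), one = 0\<rparr>"
  interpret group G
    by (rule groupI) (auto simp: G_def add.assoc intro: exI[of _ "- x" for x] bexI[of _ "- x" for x])
  have inv_self: "inv\<^bsub>G\<^esub> x = x" for x
    by (rule inv_equality) (simp_all add: G_def assms)
  fix p :: nat
  assume p: "prime p" "p dvd CARD('a)"
  then obtain m where "order G = p ^ 1 * m"
    by (auto simp: order_def G_def)
  then obtain H where H: "subgroup H G" "card H = p"
    using sylow_thm[OF p(1) is_group, of 1 m] by (auto simp: G_def)
  have "\<not> card H \<le> Suc 0"
    using H(2) prime_gt_1_nat[OF p(1)] by simp
  then obtain x where x: "x \<in> H" "x \<noteq> 0"
    using card_le_Suc0_iff_eq[of H] by (auto simp: G_def)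
  have "subgroup {0, x} G"
    by (rule subgroupI) (simp_all add: inv_self, auto simp: G_def assms)
  then have "subgroup {0, x} (G\<lparr>carrier := H\<rparr>)"
    using subgroup_incl[OF _ H(1)] x subgroup.one_closed[OF H(1)] by (auto simp: G_def)
  with group.lagrange[OF subgroup.subgroup_is_group[OF H(1) is_group]]
  have "card (rcosets\<^bsub>G\<lparr>carrier := H\<rparr>\<^esub> {0, x}) * card {0, x} = card H"
    by (simp add: order_def)
  then have "card {0, x} dvd card H"
    by (metis dvd_triv_right)
  then have "2 dvd p"
    using x H(2) by (simp add: numeral_2_eq_2)
  then show "p = 2"
    using p(1) primes_dvd_imp_eq two_is_prime_nat by metis
qed

section \<open>Unitary involutions of \<open>SU\<^sub>3(q)\<close>\<close>

definition frob :: "nat \<Rightarrow> 'a::field \<Rightarrow> 'a" where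
  "frob q x = x ^ q"

definition herm :: "nat \<Rightarrow> 'a::field^'n \<Rightarrow> 'a^'n \<Rightarrow> 'a" where
  "herm q u v = (\<Sum>i\<in>UNIV. u $ i * frob q (v $ i))"

definition unitary :: "nat \<Rightarrow> 'a::field^3^3 \<Rightarrow> bool" where
  "unitary q A \<longleftrightarrow> A ** conj_transpose q A = mat 1"

lemma SU3_carrier: "A \<in> carrier (SU3 q) \<longleftrightarrow> unitary q A \<and> det A = 1"
  by (simp add: SU3_def unitary_def)

lemma SU3_mult [simp]: "A \<otimes>\<^bsub>SU3 q\<^esub> B = A ** B"
  by (simp add: SU3_def)

lemma SU3_one [simp]: "\<one>\<^bsub>SU3 q\<^esub> = mat 1"
  by (simp add: SU3_def)

lemma involutions_SU3:
  "a \<in> involutions (SU3 q) \<longleftrightarrow> unitary q a \<and> det a = 1 \<and> a \<noteq> mat 1 \<and> a ** a = mat 1"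
  by (auto simp: involutions_def SU3_carrier)

context
  fixes q :: nat
  assumes card_k: "CARD('k::{field,finite}) = q ^ 2" and even_q: "even q"
begin

lemma CHAR_eq_2: "CHAR('k) = 2"
proof (rule CHAR_eq_posI)
  have "(- 1 :: 'k) ^ CARD('k) = - 1"
    by (rule finite_field_power_card)
  moreover have "(- 1 :: 'k) ^ CARD('k) = 1"
    using card_k even_q by simp
  ultimately show "of_nat 2 = (0 :: 'k)"
    by (metis add_eq_0_iff2 of_nat_1 of_nat_add one_add_one)
qed (auto simp: less_2_cases_iff)

lemma diff_eq_add [simp]: "(x :: 'k) - y = x + y"
  by (rule minus_CHAR_2[OF CHAR_eq_2])

lemma two_eq_zero [simp]: "(2 :: 'k) = 0"
  using CHAR_eq_2 by (metis of_nat_CHAR of_nat_numeral)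

lemma add_self_eq_zero [simp]: "(x :: 'k) + x = 0"
  by (metis diff_eq_add diff_self)

lemma square_eq_one_imp_eq_one:
  assumes "(x :: 'k) * x = 1"
  shows "x = 1"
proof -
  have "(x + 1) * (x + 1) = 0"
    using assms by (simp add: algebra_simps)
  then show ?thesis
    by (metis add_self_eq_zero add_left_cancel mult_eq_0_iff)
qed

lemma q_power_of_two: "\<exists>m. q = 2 ^ m"
proof -
  obtain n where n: "CARD('k) = 2 ^ n"
    using card_power_of_two_if_exponent_two[where 'a='k] by auto
  then have "q dvd 2 ^ n"
    using card_k by (metis dvd_triv_left power2_eq_square)
  then show ?thesis
    by (auto simp: divides_primepow_nat)
qed

lemma frob_add [simp]: "frob q ((x :: 'k) + y) = frob q x + frob q y"
  using q_power_of_two freshmans_dream'[where x=x and y=y] CHAR_eq_2 unfolding frob_def by auto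

lemma frob_mult [simp]: "frob q ((x :: 'k) * y) = frob q x * frob q y"
  by (simp add: frob_def power_mult_distrib)

lemma frob_0 [simp]: "frob q (0 :: 'k) = 0"
  using card_k by (cases q) (simp_all add: frob_def)

lemma frob_1 [simp]: "frob q (1 :: 'k) = 1"
  by (simp add: frob_def)

lemma frob_sum: "frob q (sum (f :: _ \<Rightarrow> 'k) A) = (\<Sum>i\<in>A. frob q (f i))"
  by (induction A rule: infinite_finite_induct) simp_all

lemma frob_frob [simp]: "frob q (frob q (x :: 'k)) = x"
  using finite_field_power_card[of x] card_k by (simp add: frob_def power_mult[symmetric] power2_eq_square)

lemma frob_eq_0_iff [simp]: "frob q (x :: 'k) = 0 \<longleftrightarrow> x = 0"
  by (metis frob_0 frob_frob)

lemma frob_divide [simp]: "frob q ((x :: 'k) / y) = frob q x / frob q y"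
  by (simp add: frob_def power_divide)

lemma two_vec_eq_zero [simp]: "(2 :: 'k^'n) = 0"
  by (simp add: vec_eq_iff)

lemma two_mat_eq_zero [simp]: "(2 :: 'k^'n^'m) = 0"
  by (simp add: vec_eq_iff)

lemma herm_add_left [simp]: "herm q (u + v) (w :: 'k^'n) = herm q u w + herm q v w"
  by (simp add: herm_def distrib_right sum.distrib)

lemma herm_add_right [simp]: "herm q w (u + v :: 'k^'n) = herm q w u + herm q w v"
  by (simp add: herm_def distrib_left sum.distrib)

lemma herm_scale_left [simp]: "herm q (c *s u) (w :: 'k^'n) = c * herm q u w"
  by (simp add: herm_def sum_distrib_left mult.assoc)

lemma herm_scale_right [simp]: "herm q w (c *s u :: 'k^'n) = frob q c * herm q w u"
  by (simp add: herm_def sum_distrib_left algebra_simps)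

lemma herm_zero_right [simp]: "herm q w (0 :: 'k^'n) = 0"
  by (simp add: herm_def)

lemma herm_swap: "herm q v (u :: 'k^'n) = frob q (herm q u v)"
  by (simp add: herm_def frob_sum mult.commute)

lemma herm_nondegenerate:
  assumes "(z :: 'k^'n) \<noteq> 0"
  obtains v where "herm q v z \<noteq> 0"
proof -
  obtain i where "z $ i \<noteq> 0"
    using assms by (auto simp: vec_eq_iff)
  moreover have "frob q (axis i 1 $ j) = (axis i 1 $ j :: 'k)" for j
    by (simp add: axis_def)
  ultimately have "herm q z (axis i 1) \<noteq> 0"
    by (simp add: herm_def axis_def if_distrib[of "(*) _"] cong: if_cong)
  then show ?thesis
    using that herm_swap[of "axis i 1" z] frob_eq_0_iff by metis
qed

lemma conj_transpose_entry: "conj_transpose q (A :: 'k^3^3) $ i $ j = frob q (A $ j $ i)"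
  by (simp add: conj_transpose_def frob_def)

lemma conj_transpose_mult:
  "conj_transpose q ((A :: 'k^3^3) ** B) = conj_transpose q B ** conj_transpose q A"
  by (simp add: vec_eq_iff conj_transpose_entry matrix_matrix_mult_def frob_sum mult.commute)

lemma conj_transpose_conj_transpose [simp]:
  "conj_transpose q (conj_transpose q (A :: 'k^3^3)) = A"
  by (simp add: vec_eq_iff conj_transpose_entry)

lemma conj_transpose_mat_1 [simp]: "conj_transpose q (mat 1 :: 'k^3^3) = mat 1"
  by (simp add: vec_eq_iff conj_transpose_entry mat_def)

lemma unitary_mult:
  assumes "unitary q (A :: 'k^3^3)" and "unitary q B"
  shows "unitary q (A ** B)"
proof -
  have "(A ** B) ** conj_transpose q (A ** B) = A ** (B ** conj_transpose q B) ** conj_transpose q A"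
    by (simp add: conj_transpose_mult matrix_mul_assoc)
  then show ?thesis
    using assms by (simp add: unitary_def)
qed

lemma herm_adjoint: "herm q (A *v u) (v :: 'k^3) = herm q u (conj_transpose q A *v v)"
  by (simp add: herm_def matrix_vector_mult_def conj_transpose_def frob_sum sum_distrib_left
      sum_distrib_right algebra_simps flip: frob_def) (rule sum.swap)

lemma herm_unitary:
  assumes "unitary q A"
  shows "herm q (A *v u) (A *v v) = herm q u (v :: 'k^3)"
proof -
  have "conj_transpose q A ** A = mat 1"
    using assms matrix_left_right_inverse unfolding unitary_def by blast
  then show ?thesis
    by (simp add: herm_adjoint matrix_vector_mul_assoc)
qed

(* With w = u x v (cross product): the conjugate vectors of u and v are orthogonal, for the
   bilinear dot product, to both u and v, hence parallel to w. If w were non-zero, the cross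
   product of the two conjugate vectors, which is the conjugate of w, would vanish. *)
lemma isotropic_orthogonal_cross_eq_0:
  fixes u v :: "'k^3"
  assumes uu: "herm q u u = 0" and vv: "herm q v v = 0" and uv: "herm q u v = 0"
  shows "u$2 * v$3 = u$3 * v$2 \<and> u$3 * v$1 = u$1 * v$3 \<and> u$1 * v$2 = u$2 * v$1"
proof (rule ccontr)
  define U where "U i = frob q (u $ i)" for i
  define V where "V i = frob q (v $ i)" for i
  define w1 where "w1 = u$2 * v$3 - u$3 * v$2"
  define w2 where "w2 = u$3 * v$1 - u$1 * v$3"
  define w3 where "w3 = u$1 * v$2 - u$2 * v$1"
  assume "\<not> ?thesis"
  then have w: "w1 \<noteq> 0 \<or> w2 \<noteq> 0 \<or> w3 \<noteq> 0"
    unfolding w1_def w2_def w3_def by (metis diff_eq_add add_self_eq_zero add_left_cancel add_0)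
  have "u$1 * U 1 + u$2 * U 2 + u$3 * U 3 = 0" "v$1 * U 1 + v$2 * U 2 + v$3 * U 3 = 0"
    using uu arg_cong[OF uv, of "frob q"]
    by (simp_all add: herm_def sum_3 U_def mult.commute)
  then have "U 2 * w3 - U 3 * w2 = 0" "U 3 * w1 - U 1 * w3 = 0" "U 1 * w2 - U 2 * w1 = 0"
    unfolding w1_def w2_def w3_def by algebra+
  moreover have "u$1 * V 1 + u$2 * V 2 + u$3 * V 3 = 0" "v$1 * V 1 + v$2 * V 2 + v$3 * V 3 = 0"
    using uv vv by (simp_all add: herm_def sum_3 V_def)
  then have "V 2 * w3 - V 3 * w2 = 0" "V 3 * w1 - V 1 * w3 = 0" "V 1 * w2 - V 2 * w1 = 0"
    unfolding w1_def w2_def w3_def by algebra+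
  ultimately have "U 2 * V 3 - U 3 * V 2 = 0 \<and> U 3 * V 1 - U 1 * V 3 = 0 \<and> U 1 * V 2 - U 2 * V 1 = 0"
    using w by algebra
  then have "frob q w1 = 0" "frob q w2 = 0" "frob q w3 = 0"
    unfolding w1_def w2_def w3_def U_def V_def by simp_all
  then show False
    using w by simp
qed

lemma isotropic_orthogonal_dependent:
  assumes "herm q u u = 0" "herm q v v = 0" "herm q u v = 0" "(v :: 'k^3) \<noteq> 0"
  obtains t where "u = t *s v"
proof -
  obtain i where i: "v $ i \<noteq> 0"
    using assms(4) by (auto simp: vec_eq_iff)
  have "u = (u $ i / v $ i) *s v"
    using i isotropic_orthogonal_cross_eq_0[OF assms(1-3)] exhaust_3[of i]
    by (auto simp: vec_eq_iff forall_3 field_simps)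
  then show ?thesis
    by (rule that)
qed

lemma selfadjoint_square_zero_rank_one:
  fixes N :: "'k^3^3"
  assumes adj: "\<And>u v. herm q (N *v u) v = herm q u (N *v v)"
    and sq: "N ** N = 0" and nz: "N \<noteq> 0"
  obtains z \<alpha> where "z \<noteq> 0" "herm q z z = 0" "\<alpha> \<noteq> 0" "frob q \<alpha> = \<alpha>"
    "\<And>u. N *v u = (\<alpha> * herm q u z) *s z"
proof -
  have iso: "herm q (N *v u) (N *v v) = 0" for u v
    using adj[of u "N *v v"] sq by (simp add: matrix_vector_mul_assoc)
  obtain u0 where "N *v u0 \<noteq> 0"
    using nz by (metis matrix_eq matrix_vector_mult_0)
  define z where "z = N *v u0"
  have z: "z \<noteq> 0" "herm q z z = 0"
    using \<open>N *v u0 \<noteq> 0\<close> iso by (simp_all add: z_def)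
  have "\<exists>t. N *v u = t *s z" for u
    using isotropic_orthogonal_dependent[OF iso[of u u] z(2) iso[of u u0, folded z_def] z(1)] by metis
  then obtain t where t: "\<And>u. N *v u = t u *s z"
    by metis
  obtain v0 where "herm q v0 z \<noteq> 0"
    using herm_nondegenerate[OF z(1)] by blast
  then have e: "herm q z v0 \<noteq> 0"
    by (metis herm_swap frob_eq_0_iff)
  define \<alpha> where "\<alpha> = frob q (t v0) / herm q z v0"
  have t_eq: "t u = \<alpha> * herm q u z" for u
  proof -
    have "t u * herm q z v0 = frob q (t v0) * herm q u z"
      using adj[of u v0] by (simp add: t)
    then show ?thesis
      using e by (simp add: \<alpha>_def field_simps)
  qed
  have N_eq: "N *v u = (\<alpha> * herm q u z) *s z" for u
    by (simp add: t t_eq)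
  have "\<alpha> \<noteq> 0"
    using N_eq[of u0] z(1) by (auto simp: z_def)
  have "\<alpha> * herm q v0 z * herm q z v0 = frob q \<alpha> * herm q z v0 * herm q v0 z"
    using adj[of v0 v0] herm_swap[of v0 z] by (simp add: N_eq mult_ac)
  then have "frob q \<alpha> = \<alpha>"
    using e \<open>herm q v0 z \<noteq> 0\<close> by (simp add: mult_ac)
  show ?thesis
    by (rule that) fact+
qed

lemma unitary_involution_transvection:
  fixes a :: "'k^3^3"
  assumes "unitary q a" and "a ** a = mat 1" and "a \<noteq> mat 1"
  obtains z \<alpha> where "z \<noteq> 0" "herm q z z = 0" "\<alpha> \<noteq> 0" "frob q \<alpha> = \<alpha>"
    "\<And>u. a *v u = u + (\<alpha> * herm q u z) *s z"
proof -
  define N where "N = a + mat 1"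
  have "herm q (a *v u) v = herm q u (a *v v)" for u v
    using herm_unitary[OF assms(1), of u "a *v v"] assms(2) by (simp add: matrix_vector_mul_assoc)
  then have adj: "herm q (N *v u) v = herm q u (N *v v)" for u v
    by (simp add: N_def matrix_vector_mult_add_rdistrib)
  have "a *v (a *v u) = u" for u
    using assms(2) by (simp add: matrix_vector_mul_assoc)
  then have "N ** N = 0"
    unfolding matrix_eq
    by (simp add: N_def matrix_vector_mult_add_rdistrib matrix_vector_right_distrib
        flip: matrix_vector_mul_assoc)
  moreover have "N \<noteq> 0"
  proof
    assume "N = 0"
    have "a = N + mat 1"
      by (simp add: N_def add.assoc)
    with \<open>N = 0\<close> assms(3) show False
      by simp
  qed
  ultimately obtain z \<alpha> where "z \<noteq> 0" "herm q z z = 0" "\<alpha> \<noteq> 0" "frob q \<alpha> = \<alpha>"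
    and N: "\<And>u. N *v u = (\<alpha> * herm q u z) *s z"
    using selfadjoint_square_zero_rank_one[OF adj] by blast
  moreover have "a *v u = u + (\<alpha> * herm q u z) *s z" for u
  proof -
    have "a *v u = u + N *v u"
      by (simp add: N_def matrix_vector_mult_add_rdistrib add.left_commute)
    then show ?thesis
      by (simp add: N)
  qed
  ultimately show ?thesis
    using that by blast
qed

lemma transvections_commute:
  fixes a b :: "'k^3^3"
  assumes a: "\<And>u. a *v u = u + (\<alpha> * herm q u z) *s z"
    and b: "\<And>u. b *v u = u + (\<beta> * herm q u y) *s y"
    and "herm q z y = 0"
  shows "a ** b = b ** a"
proof -
  have "herm q y z = 0"
    using assms(3) herm_swap[of y z] by simp
  then show ?thesis
    unfolding matrix_eq using assms(3)
    by (simp add: a b algebra_simps flip: matrix_vector_mul_assoc)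
qed

lemma transvection_commuting_eigenvector:
  fixes c g :: "'k^3^3"
  assumes c: "\<And>u. c *v u = u + (\<gamma> * herm q u x) *s x" and "\<gamma> \<noteq> 0" "x \<noteq> 0"
    and "c ** g = g ** c" and "unitary q g"
  obtains \<mu> where "g *v x = \<mu> *s x" "frob q \<mu> * \<mu> = 1"
proof -
  have eq: "(\<gamma> * herm q (g *v u) x) *s x = (\<gamma> * herm q u x) *s (g *v x)" for u
  proof -
    have "c *v (g *v u) = g *v (c *v u)"
      using assms(4) by (simp add: matrix_vector_mul_assoc)
    then show ?thesis
      by (simp add: c matrix_vector_right_distrib vector_scalar_commute)
  qed
  obtain u1 where u1: "herm q u1 x \<noteq> 0"
    using herm_nondegenerate[OF assms(3)] by blast
  define \<mu> where "\<mu> = herm q (g *v u1) x / herm q u1 x"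
  have gx: "g *v x = \<mu> *s x"
    using arg_cong[OF eq[of u1], of "(*s) (inverse (\<gamma> * herm q u1 x))"] u1 assms(2)
    by (simp add: vector_smult_assoc \<mu>_def field_simps)
  have "herm q (g *v u) x = \<mu> * herm q u x" for u
    using eq[of u] assms(2,3) by (simp add: gx vector_smult_assoc mult_ac)
  then have "herm q u1 x = frob q \<mu> * \<mu> * herm q u1 x"
    using herm_unitary[OF assms(5), of u1 x] by (simp add: gx)
  then have "frob q \<mu> * \<mu> = 1"
    using u1 by simp
  with gx show ?thesis
    using that by blast
qed

lemma centres_orthogonal_if_images_proportional:
  fixes a b :: "'k^3^3"
  assumes a: "\<And>u. a *v u = u + (\<alpha> * herm q u z) *s z"
    and z: "z \<noteq> 0" "herm q z z = 0" "\<alpha> \<noteq> 0" "frob q \<alpha> = \<alpha>"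
    and b: "\<And>u. b *v u = u + (\<beta> * herm q u y) *s y"
    and y: "herm q y y = 0" "\<beta> \<noteq> 0" "frob q \<beta> = \<beta>"
    and x: "x \<noteq> 0" "herm q x x = 0"
    and \<mu>: "b *v x = \<mu> *s (a *v x)" "frob q \<mu> * \<mu> = 1"
  shows "herm q z y = 0"
proof -
  define p where "p = herm q x y"
  define r where "r = herm q x z"
  have E: "x + (\<beta> * p) *s y = \<mu> *s (x + (\<alpha> * r) *s z)"
    using \<mu>(1) by (simp add: a b p_def r_def)
  have e2: "p = \<mu> * (p + \<alpha> * r * herm q z y)"
    using arg_cong[OF E, of "\<lambda>v. herm q v y"] y(1) by (simp add: p_def r_def algebra_simps)
  have e3: "\<beta> * p * frob q p = \<mu> * (\<alpha> * r * frob q r)"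
    using arg_cong[OF E, of "\<lambda>v. herm q v x"] x(2) herm_swap[of y x] herm_swap[of z x]
    by (simp add: p_def r_def algebra_simps)
  show ?thesis
  proof (cases "r = 0")
    case True
    then have "p = 0"
      using e3 y(2) by simp
    obtain t where t: "x = t *s z"
      using isotropic_orthogonal_dependent[OF x(2) z(2) _ z(1)] True r_def by auto
    then have "t * herm q z y = 0"
      using \<open>p = 0\<close> by (simp add: p_def)
    then show ?thesis
      using t x(1) by auto
  next
    case False
    then have "\<alpha> * r * frob q r \<noteq> 0"
      using z(3) by simp
    then have "\<mu> = \<beta> * p * frob q p / (\<alpha> * r * frob q r)"
      using e3 by (metis nonzero_eq_divide_eq)
    then have "frob q \<mu> = \<mu>"
      using z(4) y(3) by (simp add: mult_ac)
    then have "\<mu> * \<mu> = 1"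
      using \<mu>(2) by simp
    then have "\<mu> = 1"
      by (rule square_eq_one_imp_eq_one)
    then show ?thesis
      using e2 z(3) False by simp
  qed
qed

lemma unitary_involutions_noncommuting_product:
  fixes a b c :: "'k^3^3"
  assumes "unitary q a" "a ** a = mat 1" "a \<noteq> mat 1"
    and "unitary q b" "b ** b = mat 1" "b \<noteq> mat 1"
    and "unitary q c" "c ** c = mat 1" "c \<noteq> mat 1"
    and "a ** b \<noteq> b ** a"
  shows "c ** (a ** b) \<noteq> (a ** b) ** c"
proof
  assume commute: "c ** (a ** b) = (a ** b) ** c"
  obtain z \<alpha> where z: "z \<noteq> 0" "herm q z z = 0" "\<alpha> \<noteq> 0" "frob q \<alpha> = \<alpha>"
    and a: "\<And>u. a *v u = u + (\<alpha> * herm q u z) *s z"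
    using unitary_involution_transvection[OF assms(1-3)] by metis
  obtain y \<beta> where y: "y \<noteq> 0" "herm q y y = 0" "\<beta> \<noteq> 0" "frob q \<beta> = \<beta>"
    and b: "\<And>u. b *v u = u + (\<beta> * herm q u y) *s y"
    using unitary_involution_transvection[OF assms(4-6)] by metis
  obtain x \<gamma> where x: "x \<noteq> 0" "herm q x x = 0" "\<gamma> \<noteq> 0" "frob q \<gamma> = \<gamma>"
    and c: "\<And>u. c *v u = u + (\<gamma> * herm q u x) *s x"
    using unitary_involution_transvection[OF assms(7-9)] by metis
  obtain \<mu> where abx: "(a ** b) *v x = \<mu> *s x" and \<mu>: "frob q \<mu> * \<mu> = 1"
    using transvection_commuting_eigenvector[OF c x(3,1) commute unitary_mult[OF assms(1,4)]] by metis
  have "a *v ((a ** b) *v x) = b *v x"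
    using assms(2) by (metis matrix_vector_mul_assoc matrix_mul_assoc matrix_mul_lid)
  then have "b *v x = \<mu> *s (a *v x)"
    by (simp add: abx vector_scalar_commute)
  then have "herm q z y = 0"
    using centres_orthogonal_if_images_proportional[OF a z b y(2-4) x(1,2) _ \<mu>] by blast
  then show False
    using transvections_commute[OF a b] assms(10) by blast
qed

lemma group_SU3: "group (SU3 q :: ('k^3^3) monoid)"
proof (rule groupI)
  fix A B :: "'k^3^3"
  assume "A \<in> carrier (SU3 q)" "B \<in> carrier (SU3 q)"
  then show "A \<otimes>\<^bsub>SU3 q\<^esub> B \<in> carrier (SU3 q)"
    by (simp add: SU3_carrier unitary_mult det_mul)
next
  fix A :: "'k^3^3"
  assume A: "A \<in> carrier (SU3 q)"
  then have inv: "conj_transpose q A ** A = mat 1"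
    using matrix_left_right_inverse by (auto simp: SU3_carrier unitary_def)
  then have "det (conj_transpose q A) = 1"
    using A det_mul[of "conj_transpose q A" A] by (simp add: SU3_carrier)
  moreover have "unitary q (conj_transpose q A)"
    using inv by (simp add: unitary_def conj_transpose_conj_transpose)
  ultimately show "\<exists>B\<in>carrier (SU3 q). B \<otimes>\<^bsub>SU3 q\<^esub> A = \<one>\<^bsub>SU3 q\<^esub>"
    using inv by (auto simp: SU3_carrier)
qed (auto simp: SU3_carrier unitary_def matrix_mul_assoc)

lemma SU3_product_centralizers_avoid_involutions:
  "product_centralizers_avoid_involutions (SU3 q :: ('k^3^3) monoid)"
  by (rule product_centralizers_avoid_involutionsI)
    (simp add: involutions_SU3 unitary_involutions_noncommuting_product)

lemma SU3_noncommuting_involutions: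
  "\<exists>a\<in>involutions (SU3 q :: ('k^3^3) monoid). \<exists>b\<in>involutions (SU3 q).
     a \<otimes>\<^bsub>SU3 q\<^esub> b \<noteq> b \<otimes>\<^bsub>SU3 q\<^esub> a"
proof -
  define P12 :: "'k^3^3" where
    "P12 = (\<chi> i j. if (i = 1 \<and> j = 2) \<or> (i = 2 \<and> j = 1) \<or> (i = 3 \<and> j = 3) then 1 else 0)"
  define P13 :: "'k^3^3" where
    "P13 = (\<chi> i j. if (i = 1 \<and> j = 3) \<or> (i = 3 \<and> j = 1) \<or> (i = 2 \<and> j = 2) then 1 else 0)"
  have "P12 \<in> involutions (SU3 q)" "P13 \<in> involutions (SU3 q)"
    by (simp_all add: involutions_SU3 unitary_def vec_eq_iff forall_3 P12_def P13_def
        matrix_matrix_mult_def sum_3 conj_transpose_entry mat_def det_3)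
  moreover have "P12 ** P13 \<noteq> P13 ** P12"
    by (simp add: vec_eq_iff forall_3 P12_def P13_def matrix_matrix_mult_def sum_3)
  ultimately show ?thesis
    by auto
qed

end

theorem proposition4p4:
  fixes q :: nat
    and k_type :: "'k::{field,finite} itself"
  assumes "CARD('k) = q ^ 2" and "even q" and "q \<noteq> 2"
  shows "(\<forall>a b. killing_adj (SU3 q :: ('k^3^3) monoid) (involutions (SU3 q)) a b
                 \<longleftrightarrow> commuting_adj (SU3 q :: ('k^3^3) monoid) (involutions (SU3 q)) a b)
       \<and> killing_reducible (SU3 q :: ('k^3^3) monoid) (involutions (SU3 q))
       \<and> killing_nondegenerate (SU3 q :: ('k^3^3) monoid) (involutions (SU3 q))
       \<and> (\<forall>a b. killing_adj (PSU3 q :: ('k^3^3) set monoid) (involutions (PSU3 q)) a b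
                 \<longleftrightarrow> commuting_adj (PSU3 q :: ('k^3^3) set monoid) (involutions (PSU3 q)) a b)
       \<and> killing_reducible (PSU3 q :: ('k^3^3) set monoid) (involutions (PSU3 q))
       \<and> killing_nondegenerate (PSU3 q :: ('k^3^3) set monoid) (involutions (PSU3 q))"
proof -
  let ?G = "SU3 q :: ('k^3^3) monoid"
  have G: "group ?G"
    using group_SU3[OF assms(1,2)] .
  have P: "product_centralizers_avoid_involutions ?G"
    using SU3_product_centralizers_avoid_involutions[OF assms(1,2)] .
  obtain u v where uv: "u \<in> involutions ?G" "v \<in> involutions ?G" "u \<otimes>\<^bsub>?G\<^esub> v \<noteq> v \<otimes>\<^bsub>?G\<^esub> u"
    using SU3_noncommuting_involutions[OF assms(1,2)] by blast
  have Z: "grp_center ?G \<inter> involutions ?G = {}"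
    using group.center_no_involutions[OF G P uv] .
  have "group (PSU3 q :: ('k^3^3) set monoid)"
    unfolding PSU3_def by (rule normal.factorgroup_is_group[OF group.center_normal[OF G]])
  moreover have "product_centralizers_avoid_involutions (PSU3 q :: ('k^3^3) set monoid)"
    unfolding PSU3_def by (rule group.Mod_center_product_centralizers_avoid_involutions[OF G _ Z P]) simp
  moreover have "\<exists>X\<in>involutions (PSU3 q :: ('k^3^3) set monoid). \<exists>Y\<in>involutions (PSU3 q).
      X \<otimes>\<^bsub>PSU3 q\<^esub> Y \<noteq> Y \<otimes>\<^bsub>PSU3 q\<^esub> X"
    unfolding PSU3_def by (rule group.Mod_center_noncommuting_involutions[OF G Z uv])
  ultimately show ?thesis
    using killing_form_of_involutions[OF G P] uv killing_form_of_involutions[of "PSU3 q"] by blast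
qed

end
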